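(* We have $$\frac1{\log2}\le\liminf_{x\downarrow0}\frac{-\log\mathbf{P}\{T_\infty\le x\}}{\log^2x}\le\limsup_{x\downarrow0}\frac{-\log\mathbf{P}\{T_\infty\le x\}}{\log^2x}\le\frac{2}{\log2}.$$
   Context: $T_\infty$ is the non-negative random variable arising as the scaling limit of the length of the heavy path in conditional Galton-Watson trees: if $\xi$ is a $\{0,1,2,\dots\}$-valued random variable with $\mathbf{E}\{\xi\}=1$ and $0<\sigma^2=\mathbf{E}\{\xi^2\}-1<\infty$, $\tau_n$ is the Galton-Watson tree with offspring law that of $\xi$ conditioned to have $n$ vertices (for those $n$ for which this has positive probability), and $L_n$ is the length (number of edges) of the path from the root of $\tau_n$ to a leaf which always continues to the child with the largest subtree (ties broken by preorder index), then $L_n/\sqrt n\to\frac2\sigma T_\infty$ in distribution, and the law of $T_\infty$ does not depend on the law of $\xi$. Equivalently, $T_\infty$ is the non-negative random variable with moments $\mathbf{E}\{T_\infty^k\}=k!/(\Phi(\frac12)\cdots\Phi(\frac k2))$, $k\ge1$, where $\Phi(q)=\int_{1/2}^1(1-x^q)\,2(2\pi x^3(1-x)^3)^{-1/2}\,dx=\frac4{\sqrt\pi}\,{}_2F_1(-\frac12,\frac32-q;\frac12;\frac12)$. *)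

theory Defs
  imports "HOL-Probability.Probability"
begin

definition heavy_Phi :: "real \<Rightarrow> real" where
  "heavy_Phi q =
     (LBINT x:{1/2..1}. (1 - x powr q) * (2 * (2 * pi * x ^ 3 * (1 - x) ^ 3) powr (- 1 / 2)))"

text \<open>
  The random variable \<open>T\<^sub>\<infinity>\<close> (the scaling limit of the length of the heavy path in conditional
  Galton--Watson trees) is specified through its law, namely as a non-negative random variable
  with moments \<open>E T^k = k! / (\<Phi>(1/2) \<cdots> \<Phi>(k/2))\<close> for \<open>k \<ge> 1\<close>. The underlying probability space
  is arbitrary.
\<close>

definition is_T_infinity :: "'a measure \<Rightarrow> ('a \<Rightarrow> real) \<Rightarrow> bool" where
  "is_T_infinity M T \<longleftrightarrow>
     prob_space M \<and>
     T \<in> borel_measurable M \<and>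
     (AE \<omega> in M. 0 \<le> T \<omega>) \<and>
     (\<forall>k::nat. k \<ge> 1 \<longrightarrow>
        integrable M (\<lambda>\<omega>. T \<omega> ^ k) \<and>
        prob_space.expectation M (\<lambda>\<omega>. T \<omega> ^ k) =
          fact k / (\<Prod>j=1..k. heavy_Phi (real j / 2)))"

text \<open>
  \<open>- log p\<close> for a probability \<open>p\<close>, with \<open>- log 0 = \<infinity>\<close>; the library convention \<open>ln 0 = 0\<close>
  would make an upper bound on \<open>- log p\<close> hold vacuously at \<open>p = 0\<close>.
\<close>

definition neg_ln :: "real \<Rightarrow> ereal" where
  "neg_ln p = (if p = 0 then \<infinity> else ereal (- ln p))"

end

theory Submission
  imports Defs "HOL-Real_Asymp.Real_Asymp"
begin

text \<open>
  Let \<open>w\<close> be the density on \<open>[1/2, 1]\<close> against which \<open>\<Phi>\<close> integrates \<open>1 - x\<^sup>q\<close>, and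
  \<open>\<phi> l = E exp (- l T)\<close>. The moment recursion \<open>\<Phi>(k/2) E T\<^sup>k = k E T\<^sup>k\<^sup>-\<^sup>1\<close>, summed over \<open>k\<close>
  (the series converges because \<open>\<Phi>(q) \<longlongrightarrow> \<infinity>\<close>), is the functional equation
  \<open>l \<phi>(l) = \<integral> w(x) (\<phi>(\<surd>x l) - \<phi>(l)) dx\<close>. Since \<open>\<phi>\<close> is decreasing and convex, it follows that
  \<open>l \<phi>(l) \<le> C \<phi>(l/\<surd>2)\<close>, while keeping only the \<open>x\<close> close to \<open>1/2\<close> gives
  \<open>\<phi>(3l/4) \<le> (1 + 8l) \<phi>(l)\<close>. Iterating these, \<open>- log \<phi>(l)\<close> lies between \<open>log\<^sup>2 l / log 2\<close> and
  \<open>log\<^sup>2 l / (2 log (4/3))\<close> up to terms linear in \<open>log l\<close>. Finally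
  \<open>P(T \<le> x) \<le> e \<phi>(1/x)\<close>, and \<open>\<phi>(l) \<le> P(T \<le> x) + exp (- l x)\<close> is used with \<open>l = x\<^sup>-\<^sup>5\<^sup>/\<^sup>4\<close>, where the
  exponential is negligible and the loss \<open>(5/4)\<^sup>2\<close> still leaves a constant below \<open>2 / log 2\<close>.
\<close>

section \<open>The weight of Phi and its singularity at 1\<close>

text \<open>The indicator makes every integral against the weight one over the whole line. Near 1
  the weight grows like \<open>(1 - x) powr (- 3 / 2)\<close>, so it is integrable only after
  multiplication by a factor vanishing at 1.\<close>

definition split_density :: "real \<Rightarrow> real" where
  "split_density x = indicator {1/2..1} x * (2 * (2 * pi * x ^ 3 * (1 - x) ^ 3) powr (- 1 / 2))"

lemma split_density_nonneg: "0 \<le> split_density x"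
  by (auto simp: split_density_def indicator_def)

lemma split_density_measurable [measurable]: "split_density \<in> borel_measurable borel"
  unfolding split_density_def by measurable

lemma split_density_outside: "x \<notin> {1/2..1} \<Longrightarrow> split_density x = 0"
  by (simp add: split_density_def)

text \<open>Follows from \<open>pi < 4\<close>, \<open>x <= 1\<close> and
  \<open>1 - x <= 2 * d\<close>. Small \<open>d\<close> will show that Phi is unbounded;
  \<open>d = 1/4\<close> bounds the weight below by 2 on \<open>{1/2..3/4}\<close>.\<close>

lemma split_density_ge:
  assumes "0 < d" "d \<le> 1/4" "1 - 2 * d \<le> x" "x \<le> 1 - d"
  shows "split_density x \<ge> 1 / (4 * d * sqrt d)"
proof -
  let ?y = "2 * pi * x ^ 3 * (1 - x) ^ 3"
  have x: "1/2 \<le> x" "x < 1" using assms by auto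
  have y0: "0 < ?y" using x by (intro mult_pos_pos) auto
  have "?y \<le> 2 * 4 * 1 ^ 3 * (2 * d) ^ 3"
    using x assms pi_less_4 by (intro mult_mono power_mono) auto
  also have "\<dots> = 64 * d ^ 3" by (simp add: power3_eq_cube)
  finally have "sqrt ?y \<le> sqrt (64 * d ^ 3)" by (rule real_sqrt_le_mono)
  also have "64 * d ^ 3 = (8 * d)\<^sup>2 * d" by (simp add: power2_eq_square power3_eq_cube)
  also have "sqrt \<dots> = 8 * d * sqrt d" using assms by (simp add: real_sqrt_mult)
  finally have *: "sqrt ?y \<le> 8 * d * sqrt d" .
  have "1 / (4 * d * sqrt d) = 2 / (8 * d * sqrt d)" using assms by simp
  also have "\<dots> \<le> 2 / sqrt ?y" using * y0 by (intro divide_left_mono mult_pos_pos) (use assms in auto)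
  also have "\<dots> = 2 * ?y powr (- 1 / 2)"
    using y0 by (simp add: powr_minus_divide powr_half_sqrt)
  also have "\<dots> = split_density x" using x by (simp add: split_density_def)
  finally show ?thesis .
qed

lemma integrable_inverse_sqrt_reflected: "set_integrable lborel {0<..<1} (\<lambda>x::real. 1 / sqrt (1 - x))"
proof -
  have "set_integrable lborel (einterval 0 1) (\<lambda>x::real. 1 / sqrt (1 - x))"
  proof (rule interval_integral_FTC_nonneg(1)[where F = "\<lambda>x. - 2 * sqrt (1 - x)" and A = "-2" and B = 0])
    show "(0::ereal) < 1" by simp
  next
    fix x :: real assume "0 < ereal x" "ereal x < 1"
    then show "DERIV (\<lambda>x. - 2 * sqrt (1 - x)) x :> 1 / sqrt (1 - x)"
      by (auto intro!: derivative_eq_intros simp: field_simps)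
    show "isCont (\<lambda>x. 1 / sqrt (1 - x)) x"
      using \<open>ereal x < 1\<close> by (intro continuous_intros) auto
  next
    show "AE x in lborel. 0 < ereal x \<longrightarrow> ereal x < 1 \<longrightarrow> 0 \<le> 1 / sqrt (1 - x)" by simp
    show "(((\<lambda>x. - 2 * sqrt (1 - x)) \<circ> real_of_ereal) \<longlongrightarrow> -2) (at_right 0)"
      unfolding zero_ereal_def by (subst ereal_tendsto_simps) (auto intro!: tendsto_eq_intros)
    show "(((\<lambda>x. - 2 * sqrt (1 - x)) \<circ> real_of_ereal) \<longlongrightarrow> 0) (at_left 1)"
      unfolding one_ereal_def by (subst ereal_tendsto_simps) (auto intro!: tendsto_eq_intros)
  qed
  moreover have "einterval 0 1 = {0<..<1}" by (auto simp: einterval_def)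
  ultimately show ?thesis by simp
qed

text \<open>One factor \<open>1 - x\<close> weakens the singularity to that of
  \<open>1 / sqrt (1 - x)\<close>. The constant 4 in the majorant comes from \<open>pi >= 2\<close>
  and \<open>x >= 1/2\<close>.\<close>

lemma integrable_split_density_1: "integrable lborel (\<lambda>x. split_density x * (1 - x))"
proof (rule Bochner_Integration.integrable_bound)
  show "integrable lborel (\<lambda>x. 4 * (indicator {0<..<1} x *\<^sub>R (1 / sqrt (1 - x))))"
    using integrable_inverse_sqrt_reflected unfolding set_integrable_def by (rule integrable_mult_right)
  show "(\<lambda>x. split_density x * (1 - x)) \<in> borel_measurable lborel" by measurable
  show "AE x in lborel. norm (split_density x * (1 - x)) \<le> norm (4 * (indicator {0<..<1} x *\<^sub>R (1 / sqrt (1 - x))))"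
  proof (intro AE_I2)
    fix x :: real
    show "norm (split_density x * (1 - x)) \<le> norm (4 * (indicator {0<..<1} x *\<^sub>R (1 / sqrt (1 - x))))"
    proof (cases "1/2 \<le> x \<and> x < 1")
      case True
      let ?y = "2 * pi * x ^ 3 * (1 - x) ^ 3"
      have y0: "0 < ?y" using True by (intro mult_pos_pos) auto
      have "2 * 2 * (1/2) ^ 3 * (1 - x) ^ 3 \<le> ?y"
        using True pi_ge_two by (intro mult_mono power_mono) auto
      then have "sqrt ((1/2) * (1 - x) ^ 3) \<le> sqrt ?y" by (intro real_sqrt_le_mono) (simp add: power3_eq_cube)
      \<comment> \<open>Lowering the factor 1/2 to 1/4 leaves a perfect square to pull out of the
        root.\<close>
      moreover have "((1 - x) * (1/2))\<^sup>2 * (1 - x) \<le> (1/2) * (1 - x) ^ 3"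
        using True by (simp add: power2_eq_square power3_eq_cube)
      then have "sqrt (((1 - x) * (1/2))\<^sup>2 * (1 - x)) \<le> sqrt ((1/2) * (1 - x) ^ 3)" by (rule real_sqrt_le_mono)
      moreover have "sqrt (((1 - x) * (1/2))\<^sup>2 * (1 - x)) = (1 - x) / 2 * sqrt (1 - x)"
        using True by (simp add: real_sqrt_mult)
      ultimately have "(1 - x) / 2 * sqrt (1 - x) \<le> sqrt ?y" by linarith
      then have "2 / sqrt ?y * (1 - x) \<le> 2 / ((1 - x) / 2 * sqrt (1 - x)) * (1 - x)"
        using True y0 by (intro mult_right_mono divide_left_mono mult_pos_pos) auto
      also have "\<dots> = 4 / sqrt (1 - x)" using True by (simp add: field_simps)
      also have "2 / sqrt ?y = split_density x"
        using y0 True by (simp add: split_density_def powr_minus_divide powr_half_sqrt)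
      finally show ?thesis using True split_density_nonneg[of x] by simp
    next
      case False
      then have "split_density x * (1 - x) = 0"
        by (cases "x = 1") (auto simp: split_density_outside)
      then show ?thesis by (simp only: norm_zero norm_ge_zero)
    qed
  qed
qed

text \<open>Bernoulli's inequality at \<open>sqrt x\<close>, then \<open>x <= sqrt x\<close>. The
  factor \<open>1 - x\<close> gained here is what integrability against the weight requires.\<close>

lemma one_minus_sqrt_power_bounds:
  assumes "0 \<le> x" "x \<le> 1"
  shows "0 \<le> 1 - sqrt x ^ k" "1 - sqrt x ^ k \<le> real k * (1 - x)"
proof -
  show "0 \<le> 1 - sqrt x ^ k" using assms by (simp add: power_le_one)
  have "1 + real k * (sqrt x - 1) \<le> (1 + (sqrt x - 1)) ^ k"
    by (rule Bernoulli_inequality) (use assms in \<open>simp add: order_trans[of "-1" 0]\<close>)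
  then have "1 - sqrt x ^ k \<le> real k * (1 - sqrt x)" by (simp add: algebra_simps)
  also have "x \<le> sqrt x" using assms by (intro real_le_rsqrt) (simp add: power2_eq_square mult_left_le)
  then have "real k * (1 - sqrt x) \<le> real k * (1 - x)" by (intro mult_left_mono) auto
  finally show "1 - sqrt x ^ k \<le> real k * (1 - x)" .
qed

lemma split_density_times_nonneg: "0 \<le> split_density x * (1 - sqrt x ^ k)"
  using one_minus_sqrt_power_bounds(1)[of x k] split_density_nonneg[of x]
  by (cases "x \<in> {1/2..1}") (auto simp: split_density_outside)

lemma integrable_split_density: "integrable lborel (\<lambda>x. split_density x * (1 - sqrt x ^ k))"
proof (rule Bochner_Integration.integrable_bound)
  show "integrable lborel (\<lambda>x. real k * (split_density x * (1 - x)))"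
    using integrable_split_density_1 by (rule integrable_mult_right)
  show "(\<lambda>x. split_density x * (1 - sqrt x ^ k)) \<in> borel_measurable lborel" by measurable
  have "split_density x * (1 - sqrt x ^ k) \<le> real k * (split_density x * (1 - x))" for x
    using mult_left_mono[OF one_minus_sqrt_power_bounds(2)[of x k] split_density_nonneg[of x]]
    by (cases "x \<in> {1/2..1}") (auto simp: split_density_outside algebra_simps)
  then show "AE x in lborel. norm (split_density x * (1 - sqrt x ^ k)) \<le> norm (real k * (split_density x * (1 - x)))"
    using split_density_times_nonneg by (intro AE_I2) (metis abs_of_nonneg abs_ge_self order_trans real_norm_def)
qed

section \<open>Phi at half-integers\<close>

text \<open>The moments involve Phi only at half-integers, where the real power becomes a natural
  power of \<open>sqrt x\<close>; this form matches the coefficients of a power series evaluated at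
  \<open>sqrt x * l\<close>.\<close>

lemma heavy_Phi_half:
  "heavy_Phi (real k / 2) = (\<integral>x. split_density x * (1 - sqrt x ^ k) \<partial>lborel)"
proof -
  have "indicator {1/2..1} x * ((1 - x powr (real k / 2)) * (2 * (2 * pi * x ^ 3 * (1 - x) ^ 3) powr (- 1 / 2)))
      = split_density x * (1 - sqrt x ^ k)" for x
  proof (cases "x \<in> {1/2..1}")
    case True
    then have "x powr (real k / 2) = sqrt x ^ k"
      by (simp add: powr_half_sqrt[symmetric] powr_power)
    then show ?thesis by (simp add: split_density_def)
  qed (simp add: split_density_outside)
  then show ?thesis
    unfolding heavy_Phi_def set_lebesgue_integral_def real_scaleR_def by (simp only:)
qed

lemma heavy_Phi_0: "heavy_Phi 0 = 0"
  using heavy_Phi_half[of 0] by simp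

text \<open>Only the window \<open>{1 - 2 * d..1 - d}\<close>, of length \<open>d\<close>, is kept;
  there \<open>split_density_ge\<close> applies and \<open>1 - sqrt x ^ k\<close> is smallest at the
  right end.\<close>

lemma heavy_Phi_half_ge:
  assumes d: "0 < d" "d \<le> 1/4"
  shows "heavy_Phi (real k / 2) \<ge> (1 - sqrt (1 - d) ^ k) / (4 * sqrt d)"
proof -
  have "(\<integral>x. indicator {1 - 2 * d..1 - d} x * ((1 - sqrt (1 - d) ^ k) / (4 * d * sqrt d)) \<partial>lborel)
     \<le> heavy_Phi (real k / 2)"
    unfolding heavy_Phi_half
  proof (rule integral_mono)
    show "integrable lborel (\<lambda>x. split_density x * (1 - sqrt x ^ k))" by (rule integrable_split_density)
    show "integrable lborel (\<lambda>x. indicator {1 - 2 * d..1 - d} x * ((1 - sqrt (1 - d) ^ k) / (4 * d * sqrt d)))"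
      by (intro integrable_mult_left) (simp add: d)
    fix x
    show "indicator {1 - 2 * d..1 - d} x * ((1 - sqrt (1 - d) ^ k) / (4 * d * sqrt d)) \<le> split_density x * (1 - sqrt x ^ k)"
    proof (cases "x \<in> {1 - 2 * d..1 - d}")
      case True
      then have "1 / (4 * d * sqrt d) * (1 - sqrt (1 - d) ^ k) \<le> split_density x * (1 - sqrt x ^ k)"
        using d split_density_ge[of d x] one_minus_sqrt_power_bounds(1)[of "1 - d" k]
        by (intro mult_mono split_density_nonneg diff_mono power_mono) auto
      then show ?thesis using True by simp
    qed (simp add: split_density_times_nonneg)
  qed
  then show ?thesis using d by simp
qed

lemma heavy_Phi_half_pos:
  assumes "0 < k" shows "0 < heavy_Phi (real k / 2)"
proof -
  have "sqrt (1 - 1/4) ^ k < 1"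
    by (rule power_less_one_iff[THEN iffD2]) (use assms in auto)
  then have "0 < (1 - sqrt (1 - 1/4) ^ k) / (4 * sqrt (1/4))" by simp
  also have "\<dots> \<le> heavy_Phi (real k / 2)" by (rule heavy_Phi_half_ge) auto
  finally show ?thesis .
qed

text \<open>For fixed \<open>d\<close> the power in \<open>heavy_Phi_half_ge\<close> dies out as
  \<open>k\<close> grows, leaving about \<open>1 / (4 * sqrt d)\<close>, which is large for small
  \<open>d\<close>.\<close>

lemma heavy_Phi_half_unbounded: "\<forall>\<^sub>F k in sequentially. B \<le> heavy_Phi (real k / 2)"
proof -
  define A where "A = max B 1"
  \<comment> \<open>Chosen so that \<open>(1/2) / (4 * sqrt d) = A\<close>; since
    \<open>A >= 1\<close>, it also satisfies \<open>d <= 1/4\<close>.\<close>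
  define d where "d = (1 / (8 * A))\<^sup>2"
  have A: "1 \<le> A" "B \<le> A" by (auto simp: A_def)
  have s: "sqrt d = 1 / (8 * A)" using A by (simp add: d_def)
  have d0: "0 < d" using A by (simp add: d_def)
  have "1 / (8 * A) \<le> 1/8" using A by (simp add: field_simps)
  then have "d \<le> (1/8)\<^sup>2" unfolding d_def using A by (intro power_mono) auto
  then have d1: "d \<le> 1/4" by (simp add: power2_eq_square)
  have "(\<lambda>k. sqrt (1 - d) ^ k) \<longlonglongrightarrow> 0" using d0 d1 by (intro LIMSEQ_power_zero) auto
  then have "\<forall>\<^sub>F k in sequentially. sqrt (1 - d) ^ k < 1/2" by (rule order_tendstoD) simp
  then show ?thesis
  proof eventually_elim
    case (elim k)
    have "B \<le> (1/2) / (4 * sqrt d)" using s A by simp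
    also have "\<dots> \<le> (1 - sqrt (1 - d) ^ k) / (4 * sqrt d)" using elim d0 by (intro divide_right_mono) auto
    also have "\<dots> \<le> heavy_Phi (real k / 2)" by (rule heavy_Phi_half_ge[OF d0 d1])
    finally show ?case .
  qed
qed

section \<open>The moment series\<close>

text \<open>This is the \<open>k\<close>-th moment of T divided by \<open>fact k\<close>, hence up
  to sign the Taylor coefficient of the Laplace transform at 0.\<close>

definition moment_coeff :: "nat \<Rightarrow> real" where
  "moment_coeff k = 1 / (\<Prod>j=1..k. heavy_Phi (real j / 2))"

lemma moment_coeff_pos: "0 < moment_coeff k"
  unfolding moment_coeff_def by (intro divide_pos_pos prod_pos) (auto intro: heavy_Phi_half_pos)

lemma moment_coeff_Suc: "moment_coeff (Suc k) * heavy_Phi (real (Suc k) / 2) = moment_coeff k"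
  using heavy_Phi_half_pos[of "Suc k"] by (simp add: moment_coeff_def del: of_nat_Suc)

text \<open>Consecutive terms have ratio \<open>y / heavy_Phi (real (Suc k) / 2)\<close>, which
  tends to 0 because Phi is unbounded along half-integers.\<close>

lemma summable_moment_coeff:
  assumes "0 \<le> y" shows "summable (\<lambda>k. moment_coeff k * y ^ k)"
proof -
  obtain N where N: "\<And>k. N \<le> k \<Longrightarrow> 2 * y + 1 \<le> heavy_Phi (real k / 2)"
    using heavy_Phi_half_unbounded[of "2 * y + 1"] unfolding eventually_sequentially by blast
  show ?thesis
  proof (rule summable_ratio_test[where c = "1/2" and N = N])
    fix n assume "N \<le> n"
    then have "2 * y + 1 \<le> heavy_Phi (real (Suc n) / 2)" using N by (metis le_SucI)
    then have "moment_coeff (Suc n) * (2 * y) \<le> moment_coeff (Suc n) * heavy_Phi (real (Suc n) / 2)"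
      using moment_coeff_pos[of "Suc n"] by (intro mult_left_mono) auto
    then have "moment_coeff (Suc n) * (2 * y) \<le> moment_coeff n" unfolding moment_coeff_Suc .
    then have "moment_coeff (Suc n) * (2 * y) * y ^ n \<le> moment_coeff n * y ^ n"
      using assms by (intro mult_right_mono) auto
    then show "norm (moment_coeff (Suc n) * y ^ Suc n) \<le> 1/2 * norm (moment_coeff n * y ^ n)"
      using assms moment_coeff_pos[of n] moment_coeff_pos[of "Suc n"] by (simp add: abs_mult)
  qed simp
qed

text \<open>Shifting back by whole periods reaches the base interval without increasing
  \<open>G\<close>. Applied below to the log-transform with the exact solution of its recurrence
  removed.\<close>

lemma bound_from_period:
  fixes G :: "real \<Rightarrow> real"
  assumes p: "0 < p"
    and step: "\<And>L. p \<le> L \<Longrightarrow> G (L - p) \<le> G L"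
    and base: "\<And>L. 0 \<le> L \<Longrightarrow> L \<le> p \<Longrightarrow> D \<le> G L"
    and "0 \<le> L"
  shows "D \<le> G L"
proof -
  have "D \<le> G L" if "0 \<le> L" "L \<le> real n * p" for n L
    using that
  proof (induction n arbitrary: L)
    case 0
    then show ?case using base[of L] p by simp
  next
    case (Suc n)
    show ?case
    proof (cases "L \<le> p")
      case False
      then have "D \<le> G (L - p)" using Suc by (intro Suc.IH) (auto simp: algebra_simps)
      then show ?thesis using step[of L] False by simp
    qed (use Suc base in auto)
  qed
  moreover obtain n where "L < real n * p" using reals_Archimedean3[OF p] by blast
  ultimately show ?thesis using \<open>0 \<le> L\<close> by (meson less_imp_le)
qed

section \<open>The Laplace transform and its power series\<close>

locale T_infinity =
  fixes M :: "'a measure" and T :: "'a \<Rightarrow> real"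
  assumes is_T: "is_T_infinity M T"
begin

sublocale prob_space M using is_T by (simp add: is_T_infinity_def)

lemma T_measurable [measurable]: "T \<in> borel_measurable M"
  using is_T by (simp add: is_T_infinity_def)

lemma T_nonneg: "AE \<omega> in M. 0 \<le> T \<omega>"
  using is_T by (simp add: is_T_infinity_def)

lemma T_moment: "integrable M (\<lambda>\<omega>. T \<omega> ^ k)" "expectation (\<lambda>\<omega>. T \<omega> ^ k) = fact k * moment_coeff k"
  \<comment> \<open>The defining moments start at \<open>k = 1\<close>; for \<open>k = 0\<close>
    both sides are 1, by total mass and the empty product.\<close>
  using is_T by (cases "k = 0"; simp add: is_T_infinity_def moment_coeff_def prob_space)+

definition laplace :: "real \<Rightarrow> real" where
  "laplace l = expectation (\<lambda>\<omega>. exp (- (l * T \<omega>)))"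

text \<open>The exponential series is integrated term by term. As T is almost surely non-negative,
  the norms have integrals \<open>moment_coeff k * \<bar>l\<bar> ^ k\<close>, which are summable for
  every real \<open>l\<close>.\<close>

lemma laplace_series:
  shows laplace_integrable: "integrable M (\<lambda>\<omega>. exp (- (l * T \<omega>)))"
    and laplace_sums: "(\<lambda>k. moment_coeff k * (- l) ^ k) sums laplace l"
proof -
  define f where "f k \<omega> = (- l) ^ k / fact k * T \<omega> ^ k" for k \<omega>
  have f_int: "integrable M (f k)" for k
    unfolding f_def by (intro integrable_mult_right T_moment)
  have f_eq: "f k \<omega> = (- l * T \<omega>) ^ k /\<^sub>R fact k" for k \<omega>
    unfolding f_def power_mult_distrib by (simp add: divide_inverse)
  have exp_eq: "(\<Sum>k. f k \<omega>) = exp (- (l * T \<omega>))" for \<omega>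
    by (simp add: exp_def f_eq)
  have "(\<integral>\<omega>. norm (f k \<omega>) \<partial>M) = moment_coeff k * \<bar>l\<bar> ^ k" for k
  proof -
    have "(\<integral>\<omega>. norm (f k \<omega>) \<partial>M) = (\<integral>\<omega>. \<bar>l\<bar> ^ k / fact k * T \<omega> ^ k \<partial>M)"
    proof (rule integral_cong_AE)
      show "AE \<omega> in M. norm (f k \<omega>) = \<bar>l\<bar> ^ k / fact k * T \<omega> ^ k"
        using T_nonneg by eventually_elim (simp add: f_def abs_mult power_abs)
    qed (simp_all add: f_def)
    then show ?thesis by (simp add: T_moment)
  qed
  then have summ: "summable (\<lambda>k. \<integral>\<omega>. norm (f k \<omega>) \<partial>M)" by (simp add: summable_moment_coeff)
  have "summable (\<lambda>k. norm (f k \<omega>))" for \<omega>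
    using summable_norm_exp[of "- l * T \<omega>"] unfolding f_eq .
  then have AE: "AE \<omega> in M. summable (\<lambda>k. norm (f k \<omega>))" by simp
  show "integrable M (\<lambda>\<omega>. exp (- (l * T \<omega>)))"
    using integrable_suminf[OF f_int AE summ] by (simp add: exp_eq)
  have "integral\<^sup>L M (f k) = moment_coeff k * (- l) ^ k" for k
    unfolding f_def by (subst integral_mult_right_zero) (simp add: T_moment)
  then show "(\<lambda>k. moment_coeff k * (- l) ^ k) sums laplace l"
    using sums_integral[OF f_int AE summ] by (simp add: exp_eq laplace_def)
qed

lemma laplace_pos: "0 < laplace l"
proof -
  have "laplace l \<noteq> 0"
    unfolding laplace_def
    by (subst integral_nonneg_eq_0_iff_AE) (auto simp: laplace_integrable)
  moreover have "0 \<le> laplace l" unfolding laplace_def by simp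
  ultimately show ?thesis by simp
qed

lemma laplace_antimono: "l \<le> l' \<Longrightarrow> laplace l' \<le> laplace l"
  unfolding laplace_def using T_nonneg
  by (intro integral_mono_AE laplace_integrable) (auto intro: mult_right_mono)

lemma laplace_0: "laplace 0 = 1"
  by (simp add: laplace_def prob_space)

lemma laplace_convex:
  assumes "0 \<le> t" "t \<le> 1"
  shows "laplace ((1 - t) * l + t * l') \<le> (1 - t) * laplace l + t * laplace l'"
proof -
  have "exp (- (((1 - t) * l + t * l') * T \<omega>)) \<le> (1 - t) * exp (- (l * T \<omega>)) + t * exp (- (l' * T \<omega>))" for \<omega>
    using convex_onD[OF exp_convex assms, of "- l * T \<omega>" "- l' * T \<omega>"]
    by (simp add: algebra_simps)
  then have "laplace ((1 - t) * l + t * l') \<le> expectation (\<lambda>\<omega>. (1 - t) * exp (- (l * T \<omega>)) + t * exp (- (l' * T \<omega>)))"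
    unfolding laplace_def
    by (intro integral_mono Bochner_Integration.integrable_add integrable_mult_right laplace_integrable)
  also have "\<dots> = (1 - t) * laplace l + t * laplace l'"
    unfolding laplace_def
    by (subst Bochner_Integration.integral_add) (auto intro!: integrable_mult_right laplace_integrable)
  finally show ?thesis .
qed

section \<open>The functional equation and its one-step inequalities\<close>

text \<open>Expand the difference of transforms in powers of \<open>l\<close> and integrate against
  the weight: the \<open>k\<close>-th term acquires the factor
  \<open>heavy_Phi (real k / 2)\<close>, which lowers the index of \<open>moment_coeff\<close> by
  one and thereby produces the series of \<open>l * laplace l\<close>.\<close>

lemma laplace_equation:
  assumes "0 \<le> l"
  shows "integrable lborel (\<lambda>x. split_density x * (laplace (sqrt x * l) - laplace l))"
    and "l * laplace l = (\<integral>x. split_density x * (laplace (sqrt x * l) - laplace l) \<partial>lborel)"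
proof -
  define f where "f k x = - (moment_coeff k * (- l) ^ k) * (split_density x * (1 - sqrt x ^ k))" for k x
  have f_int: "integrable lborel (f k)" for k
    unfolding f_def by (intro integrable_mult_right integrable_split_density)
  have sums: "(\<lambda>k. f k x) sums (split_density x * (laplace (sqrt x * l) - laplace l))" for x
  proof -
    have "(\<lambda>k. split_density x * (moment_coeff k * (- (sqrt x * l)) ^ k - moment_coeff k * (- l) ^ k)) sums
       (split_density x * (laplace (sqrt x * l) - laplace l))"
      by (intro sums_mult sums_diff laplace_sums)
    moreover have "(- (sqrt x * l)) ^ k = sqrt x ^ k * (- l) ^ k" for k
      by (metis mult_minus_right power_mult_distrib)
    ultimately show ?thesis by (simp add: f_def algebra_simps)
  qed
  have norm_f: "norm (f k x) = moment_coeff k * l ^ k * (split_density x * (1 - sqrt x ^ k))" for k x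
  proof -
    have "norm (split_density x * (1 - sqrt x ^ k)) = split_density x * (1 - sqrt x ^ k)"
      using split_density_times_nonneg by (simp only: real_norm_def abs_of_nonneg)
    moreover have "norm (- (moment_coeff k * (- l) ^ k)) = moment_coeff k * l ^ k"
      using assms moment_coeff_pos[of k] by (simp add: abs_mult power_abs)
    ultimately show ?thesis unfolding f_def norm_mult[of "- (moment_coeff k * (- l) ^ k)"] by (simp only:)
  qed
  have "summable (\<lambda>k. norm (f k x))" for x
  proof (cases "x \<in> {1/2..1}")
    case True
    have "summable (\<lambda>k. split_density x * (moment_coeff k * l ^ k - moment_coeff k * (sqrt x * l) ^ k))"
      using assms True by (intro summable_mult summable_diff summable_moment_coeff) auto
    then show ?thesis unfolding norm_f by (simp add: algebra_simps power_mult_distrib)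
  qed (simp add: f_def split_density_outside)
  then have AE: "AE x in lborel. summable (\<lambda>k. norm (f k x))" by simp
  have norm_int: "(\<integral>x. norm (f k x) \<partial>lborel) = moment_coeff k * l ^ k * heavy_Phi (real k / 2)" for k
    by (simp only: norm_f heavy_Phi_half integral_mult_right_zero)
  \<comment> \<open>The recursion absorbs the growing factor Phi, so the integrated norms are again
    summable.\<close>
  have "summable (\<lambda>k. moment_coeff (Suc k) * l ^ Suc k * heavy_Phi (real (Suc k) / 2))"
  proof -
    have "moment_coeff (Suc k) * l ^ Suc k * heavy_Phi (real (Suc k) / 2) = l * (moment_coeff k * l ^ k)" for k
      by (subst moment_coeff_Suc[symmetric]) simp
    then show ?thesis using assms by (simp only:) (intro summable_mult summable_moment_coeff)
  qed
  then have summ: "summable (\<lambda>k. \<integral>x. norm (f k x) \<partial>lborel)"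
    unfolding norm_int by (subst (asm) summable_Suc_iff)
  have suminf: "(\<Sum>k. f k x) = split_density x * (laplace (sqrt x * l) - laplace l)" for x
    using sums by (rule sums_unique[symmetric])
  show "integrable lborel (\<lambda>x. split_density x * (laplace (sqrt x * l) - laplace l))"
    using integrable_suminf[OF f_int AE summ] by (simp add: suminf)
  have f_integral: "integral\<^sup>L lborel (f k) = - (moment_coeff k * (- l) ^ k) * heavy_Phi (real k / 2)" for k
    unfolding f_def heavy_Phi_half by (rule integral_mult_right_zero)
  have "(\<lambda>k. integral\<^sup>L lborel (f k)) sums (\<integral>x. split_density x * (laplace (sqrt x * l) - laplace l) \<partial>lborel)"
    using sums_integral[OF f_int AE summ] by (simp add: suminf)
  \<comment> \<open>The term with \<open>k = 0\<close> vanishes since Phi(0) = 0, which permits the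
    index shift.\<close>
  then have "(\<lambda>k. integral\<^sup>L lborel (f (Suc k))) sums (\<integral>x. split_density x * (laplace (sqrt x * l) - laplace l) \<partial>lborel)"
    by (subst sums_Suc_iff) (simp add: f_integral heavy_Phi_0)
  moreover have "integral\<^sup>L lborel (f (Suc k)) = l * (moment_coeff k * (- l) ^ k)" for k
    unfolding f_integral by (subst moment_coeff_Suc[symmetric]) simp
  moreover have "(\<lambda>k. l * (moment_coeff k * (- l) ^ k)) sums (l * laplace l)"
    by (intro sums_mult laplace_sums)
  ultimately show "l * laplace l = (\<integral>x. split_density x * (laplace (sqrt x * l) - laplace l) \<partial>lborel)"
    by (simp add: sums_unique2)
qed

text \<open>
  The density \<open>w\<close> is not integrable at \<open>1\<close>; convexity on the chord from \<open>l/\<surd>2\<close> to \<open>l\<close> supplies the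
  missing factor \<open>1 - \<surd>x\<close>, which integrates to \<open>\<Phi>(1/2)\<close>.
\<close>
lemma laplace_le_step:
  assumes "0 \<le> l"
  shows "l * laplace l \<le> heavy_Phi (1/2) / (1 - 1 / sqrt 2) * laplace (l / sqrt 2)"
proof -
  define c where "c = 1 - 1 / sqrt 2"
  have c: "0 < c" by (simp add: c_def)
  have "split_density x * (laplace (sqrt x * l) - laplace l) \<le> split_density x * (1 - sqrt x) * (laplace (l / sqrt 2) / c)" for x
  proof (cases "x \<in> {1/2..1}")
    case True
    \<comment> \<open>\<open>t\<close> locates \<open>sqrt x * l\<close> on the chord: 0 at
      \<open>l\<close>, 1 at \<open>l / sqrt 2\<close>.\<close>
    define t where "t = (1 - sqrt x) / c"
    have "1 / sqrt 2 \<le> sqrt x" using True by (intro real_le_rsqrt) (simp add: power_divide)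
    then have t: "0 \<le> t" "t \<le> 1" using True c by (auto simp: t_def c_def)
    have "sqrt x = 1 - t * c" using c by (simp add: t_def)
    moreover have "(1 - t * c) * l = (1 - t) * l + t * (l / sqrt 2)" by (simp add: c_def algebra_simps)
    ultimately have "sqrt x * l = (1 - t) * l + t * (l / sqrt 2)" by simp
    then have "laplace (sqrt x * l) \<le> (1 - t) * laplace l + t * laplace (l / sqrt 2)"
      using laplace_convex[OF t] by metis
    also have "\<dots> \<le> laplace l + t * laplace (l / sqrt 2)"
      using t laplace_pos[of l] by (simp add: algebra_simps)
    finally have "laplace (sqrt x * l) - laplace l \<le> (1 - sqrt x) * (laplace (l / sqrt 2) / c)"
      by (simp add: t_def)
    then show ?thesis using split_density_nonneg[of x] by (metis mult.assoc mult_left_mono)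
  qed (simp add: split_density_outside)
  then have "(\<integral>x. split_density x * (laplace (sqrt x * l) - laplace l) \<partial>lborel)
      \<le> (\<integral>x. split_density x * (1 - sqrt x) * (laplace (l / sqrt 2) / c) \<partial>lborel)"
    using laplace_equation(1)[OF assms] integrable_split_density[of 1]
    by (intro integral_mono integrable_mult_left) auto
  also have "\<dots> = heavy_Phi (1/2) * (laplace (l / sqrt 2) / c)"
    using heavy_Phi_half[of 1] by simp
  finally show ?thesis using laplace_equation(2)[OF assms] by (simp add: c_def)
qed

text \<open>On \<open>{1/2..9/16}\<close> one has \<open>sqrt x <= 3/4\<close> and weight at least
  2. The interval has length 1/16, so the functional equation gives
  \<open>l * laplace l >= (laplace (3/4 * l) - laplace l) / 8\<close>.\<close>

lemma laplace_ge_step: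
  assumes "0 \<le> l"
  shows "laplace (3/4 * l) \<le> (1 + 8 * l) * laplace l"
proof -
  have diff0: "0 \<le> laplace (sqrt x * l) - laplace l" if "x \<in> {1/2..1}" for x
  proof -
    have "sqrt x * l \<le> 1 * l" using that assms by (intro mult_right_mono) auto
    then show ?thesis using laplace_antimono[of "sqrt x * l" l] by simp
  qed
  have "(\<integral>x. indicator {1/2..9/16::real} x * (2 * (laplace (3/4 * l) - laplace l)) \<partial>lborel)
     \<le> (\<integral>x. split_density x * (laplace (sqrt x * l) - laplace l) \<partial>lborel)"
  proof (rule integral_mono)
    show "integrable lborel (\<lambda>x. split_density x * (laplace (sqrt x * l) - laplace l))"
      by (rule laplace_equation(1)[OF assms])
    show "integrable lborel (\<lambda>x::real. indicator {1/2..9/16} x * (2 * (laplace (3/4 * l) - laplace l)))"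
      by (intro integrable_mult_left) simp
    fix x :: real
    show "indicator {1/2..9/16::real} x * (2 * (laplace (3/4 * l) - laplace l)) \<le> split_density x * (laplace (sqrt x * l) - laplace l)"
    proof (cases "x \<in> {1/2..9/16}")
      case True
      have "2 \<le> split_density x" using True split_density_ge[of "1/4" x] by (simp add: real_sqrt_divide)
      have "sqrt x \<le> 3/4" using True by (intro real_le_lsqrt) (auto simp: power2_eq_square)
      then have "laplace (3/4 * l) \<le> laplace (sqrt x * l)"
        using assms by (intro laplace_antimono mult_right_mono) auto
      moreover have "0 \<le> laplace (3/4 * l) - laplace l"
        using laplace_antimono[of "3/4 * l" l] assms by simp
      ultimately have "2 * (laplace (3/4 * l) - laplace l) \<le> split_density x * (laplace (sqrt x * l) - laplace l)"
        using \<open>2 \<le> split_density x\<close> by (intro mult_mono) auto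
      then show ?thesis using True by simp
    next
      case False
      then show ?thesis using diff0[of x] split_density_nonneg[of x]
        by (cases "x \<in> {1/2..1}") (auto simp: split_density_outside)
    qed
  qed
  then show ?thesis unfolding laplace_equation(2)[OF assms, symmetric]
    by (simp add: algebra_simps)
qed

section \<open>Quadratic growth on the logarithmic scale\<close>

text \<open>With \<open>l = exp L\<close>, dilations of \<open>l\<close> become translations of
  \<open>L\<close>, and the one-step inequalities become difference inequalities with increment
  \<open>L\<close> plus a constant.\<close>

definition neg_ln_laplace :: "real \<Rightarrow> real" where
  "neg_ln_laplace L = - ln (laplace (exp L))"

lemma neg_ln_laplace_nonneg: "0 \<le> neg_ln_laplace L"
proof -
  have "laplace (exp L) \<le> 1" using laplace_antimono[of 0 "exp L"] by (simp add: laplace_0)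
  then show ?thesis using laplace_pos[of "exp L"] by (simp add: neg_ln_laplace_def)
qed

lemma neg_ln_laplace_mono: "L \<le> L' \<Longrightarrow> neg_ln_laplace L \<le> neg_ln_laplace L'"
  using laplace_antimono[of "exp L" "exp L'"] laplace_pos by (simp add: neg_ln_laplace_def)

lemma neg_ln_laplace_ge: "\<exists>b D. \<forall>L\<ge>0. L\<^sup>2 / ln 2 + b * L + D \<le> neg_ln_laplace L"
proof -
  define C where "C = heavy_Phi (1/2) / (1 - 1 / sqrt 2)"
  define p :: real where "p = ln 2 / 2"
  \<comment> \<open>With this \<open>b\<close>, \<open>L^2 / (2 * p) - b * L\<close> increases by
    exactly \<open>L - ln C\<close> from \<open>L - p\<close> to \<open>L\<close>; \<open>p\<close>
    is the logarithm of \<open>sqrt 2\<close>, so \<open>2 * p = ln 2\<close>.\<close>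
  define b where "b = ln C / p - 1/2"
  have C: "0 < C" using heavy_Phi_half_pos[of 1] by (simp add: C_def)
  have p: "0 < p" by (simp add: p_def)
  have exp_p: "exp (L - p) = exp L / sqrt 2" for L :: real
    by (simp add: p_def exp_diff flip: ln_sqrt)
  have step: "L - ln C + neg_ln_laplace (L - p) \<le> neg_ln_laplace L" for L
  proof -
    have "exp L * laplace (exp L) \<le> C * laplace (exp (L - p))"
      unfolding exp_p C_def by (intro laplace_le_step) simp
    then have "ln (exp L * laplace (exp L)) \<le> ln (C * laplace (exp (L - p)))"
      using laplace_pos C by simp
    then show ?thesis using laplace_pos[of "exp L"] laplace_pos[of "exp (L - p)"] C
      by (simp add: ln_mult neg_ln_laplace_def)
  qed
  have bound: "- p / 2 - \<bar>b\<bar> * p \<le> neg_ln_laplace L - L\<^sup>2 / (2 * p) + b * L" if "0 \<le> L" for L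
    using p
  proof (rule bound_from_period[where G = "\<lambda>L. neg_ln_laplace L - L\<^sup>2 / (2 * p) + b * L"])
    fix L
    have "neg_ln_laplace L - L\<^sup>2 / (2 * p) + b * L - (neg_ln_laplace (L - p) - (L - p)\<^sup>2 / (2 * p) + b * (L - p))
       = neg_ln_laplace L - neg_ln_laplace (L - p) - L + ln C"
      using p by (simp add: b_def field_simps power2_eq_square)
    then show "neg_ln_laplace (L - p) - (L - p)\<^sup>2 / (2 * p) + b * (L - p) \<le> neg_ln_laplace L - L\<^sup>2 / (2 * p) + b * L"
      using step[of L] by linarith
  next
    fix L assume L: "0 \<le> L" "L \<le> p"
    have "L\<^sup>2 / (2 * p) \<le> p\<^sup>2 / (2 * p)" using L p by (intro divide_right_mono power_mono) auto
    then have "L\<^sup>2 / (2 * p) \<le> p / 2" using p by (simp add: power2_eq_square)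
    moreover have "\<bar>b * L\<bar> \<le> \<bar>b\<bar> * p" using L by (simp add: abs_mult mult_left_mono)
    ultimately show "- p / 2 - \<bar>b\<bar> * p \<le> neg_ln_laplace L - L\<^sup>2 / (2 * p) + b * L"
      using neg_ln_laplace_nonneg[of L] by linarith
  qed (fact that)
  show ?thesis
  proof (intro exI allI impI)
    fix L :: real assume "0 \<le> L"
    then show "L\<^sup>2 / ln 2 + (- b) * L + (- p / 2 - \<bar>b\<bar> * p) \<le> neg_ln_laplace L"
      using bound[of L] by (simp add: p_def)
  qed
qed

lemma neg_ln_laplace_le: "\<exists>b D. \<forall>L\<ge>0. neg_ln_laplace L \<le> L\<^sup>2 / (2 * ln (4/3)) + b * L + D"
proof -
  define p :: real where "p = ln (4/3)"
  \<comment> \<open>Now \<open>L^2 / (2 * p) + b * L\<close> increases by exactly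
    \<open>L + ln 9\<close> over one period; the 9 comes from
    \<open>1 + 8 * exp L <= 9 * exp L\<close> for \<open>L >= 0\<close>.\<close>
  define b where "b = ln 9 / p + 1/2"
  have p: "0 < p" by (simp add: p_def)
  have exp_p: "exp (L - p) = 3/4 * exp L" for L :: real
    by (simp add: p_def exp_diff)
  have step: "neg_ln_laplace L \<le> L + ln 9 + neg_ln_laplace (L - p)" if "0 \<le> L" for L
  proof -
    have "laplace (exp (L - p)) \<le> (1 + 8 * exp L) * laplace (exp L)"
      unfolding exp_p by (intro laplace_ge_step) simp
    also have "\<dots> \<le> (9 * exp L) * laplace (exp L)"
      using that laplace_pos[of "exp L"] by (intro mult_right_mono) auto
    finally have "ln (laplace (exp (L - p))) \<le> ln (9 * exp L * laplace (exp L))"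
      using laplace_pos by simp
    then show ?thesis using laplace_pos[of "exp L"]
      by (simp add: ln_mult neg_ln_laplace_def)
  qed
  have bound: "- neg_ln_laplace p \<le> - neg_ln_laplace L + L\<^sup>2 / (2 * p) + b * L" if "0 \<le> L" for L
    using p
  proof (rule bound_from_period[where G = "\<lambda>L. - neg_ln_laplace L + L\<^sup>2 / (2 * p) + b * L"])
    fix L assume L: "p \<le> L"
    have "- neg_ln_laplace L + L\<^sup>2 / (2 * p) + b * L - (- neg_ln_laplace (L - p) + (L - p)\<^sup>2 / (2 * p) + b * (L - p))
       = - neg_ln_laplace L + neg_ln_laplace (L - p) + L + ln 9"
      using p by (simp add: b_def field_simps power2_eq_square)
    then show "- neg_ln_laplace (L - p) + (L - p)\<^sup>2 / (2 * p) + b * (L - p) \<le> - neg_ln_laplace L + L\<^sup>2 / (2 * p) + b * L"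
      using step[of L] p L by linarith
  next
    fix L assume L: "0 \<le> L" "L \<le> p"
    have "0 \<le> L\<^sup>2 / (2 * p)" "0 \<le> b * L" using L p by (auto simp: b_def)
    then show "- neg_ln_laplace p \<le> - neg_ln_laplace L + L\<^sup>2 / (2 * p) + b * L"
      using neg_ln_laplace_mono[OF L(2)] by linarith
  qed (fact that)
  show ?thesis
  proof (intro exI allI impI)
    fix L :: real assume "0 \<le> L"
    then show "neg_ln_laplace L \<le> L\<^sup>2 / (2 * ln (4/3)) + b * L + neg_ln_laplace p"
      using bound[of L] by (simp add: p_def)
  qed
qed

section \<open>From the transform to the lower tail\<close>

text \<open>The exponential Markov inequality: the indicator is dominated by
  \<open>exp (l * (x - T))\<close>.\<close>

lemma prob_le_laplace:
  assumes "0 \<le> l"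
  shows "prob {\<omega> \<in> space M. T \<omega> \<le> x} \<le> exp (l * x) * laplace l"
proof -
  have "expectation (indicator {\<omega> \<in> space M. T \<omega> \<le> x}) \<le> expectation (\<lambda>\<omega>. exp (l * x) * exp (- (l * T \<omega>)))"
  proof (rule integral_mono)
    show "indicator {\<omega> \<in> space M. T \<omega> \<le> x} \<omega> \<le> exp (l * x) * exp (- (l * T \<omega>))" for \<omega>
      using assms by (auto simp: indicator_def exp_add[symmetric] mult_left_mono)
  qed (auto intro!: integrable_mult_right laplace_integrable simp: integrable_indicator_iff less_top[symmetric])
  then show ?thesis by (simp add: laplace_def)
qed

text \<open>Split at \<open>T = x\<close>: the exponential is at most 1 below, almost surely, and at
  most \<open>exp (- l * x)\<close> above.\<close>

lemma laplace_le_prob: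
  assumes "0 \<le> l"
  shows "laplace l \<le> prob {\<omega> \<in> space M. T \<omega> \<le> x} + exp (- l * x)"
proof -
  have int: "integrable M (indicator {\<omega> \<in> space M. T \<omega> \<le> x} :: 'a \<Rightarrow> real)"
    by (auto simp: integrable_indicator_iff less_top[symmetric])
  have "laplace l \<le> expectation (\<lambda>\<omega>. indicator {\<omega> \<in> space M. T \<omega> \<le> x} \<omega> + exp (- l * x))"
    unfolding laplace_def
  proof (rule integral_mono_AE)
    show "AE \<omega> in M. exp (- (l * T \<omega>)) \<le> indicator {\<omega> \<in> space M. T \<omega> \<le> x} \<omega> + exp (- l * x)"
      using T_nonneg AE_space
    proof eventually_elim
      case (elim \<omega>)
      show ?case
      proof (cases "T \<omega> \<le> x")
        case True
        have "exp (- (l * T \<omega>)) \<le> 1" using elim assms by simp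
        then show ?thesis using True elim by (simp add: add_increasing2)
      next
        case False
        then have "l * x \<le> l * T \<omega>" using assms by (intro mult_left_mono) auto
        then show ?thesis using False by simp
      qed
    qed
  qed (use int in \<open>auto intro!: laplace_integrable\<close>)
  also have "\<dots> = prob {\<omega> \<in> space M. T \<omega> \<le> x} + exp (- l * x)"
    using int by (subst Bochner_Integration.integral_add) (auto simp: prob_space)
  finally show ?thesis .
qed

lemma eventually_neg_ln_ge:
  "\<exists>f. (f \<longlongrightarrow> 1 / ln 2) (at_right 0) \<and>
    (\<forall>\<^sub>F x in at_right 0. ereal (f x) \<le> neg_ln (prob {\<omega> \<in> space M. T \<omega> \<le> x}) / ereal ((ln x)\<^sup>2))"
proof -
  obtain b D where bD: "\<And>L. 0 \<le> L \<Longrightarrow> L\<^sup>2 / ln 2 + b * L + D \<le> neg_ln_laplace L"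
    using neg_ln_laplace_ge by blast
  \<comment> \<open>The \<open>- 1\<close> pays for the factor \<open>exp 1\<close> that the choice
    \<open>l = 1 / x\<close> produces.\<close>
  define g where "g L = (L\<^sup>2 * (1 / ln 2) + b * L + (D - 1)) / L\<^sup>2" for L :: real
  have "(g \<longlongrightarrow> 1 / ln 2) at_top"
    unfolding g_def by real_asymp
  moreover have "filterlim (\<lambda>x::real. - ln x) at_top (at_right 0)" by real_asymp
  ultimately have lim: "((\<lambda>x. g (- ln x)) \<longlongrightarrow> 1 / ln 2) (at_right 0)"
    by (rule filterlim_compose)
  have "\<forall>\<^sub>F x in at_right 0. x < (1::real)" "\<forall>\<^sub>F x in at_right 0. 0 < (x::real)"
    by (auto intro: order_tendstoD eventually_at_right_less)
  then have "\<forall>\<^sub>F x in at_right 0. ereal (g (- ln x)) \<le> neg_ln (prob {\<omega> \<in> space M. T \<omega> \<le> x}) / ereal ((ln x)\<^sup>2)"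
  proof eventually_elim
    case (elim x)
    define L where "L = - ln x"
    let ?P = "prob {\<omega> \<in> space M. T \<omega> \<le> x}"
    have L: "0 < L" "(ln x)\<^sup>2 = L\<^sup>2" "exp L = 1 / x" using elim by (auto simp: L_def exp_minus divide_inverse)
    have "?P \<le> exp (1 / x * x) * laplace (exp L)"
      unfolding L(3) using elim by (intro prob_le_laplace) simp
    then have P: "?P \<le> exp 1 * laplace (exp L)" using elim by simp
    \<comment> \<open>If the probability is 0, the right side is infinite and nothing is left to
      show.\<close>
    have "ereal (g L * L\<^sup>2) \<le> neg_ln ?P"
    proof (cases "?P = 0")
      case False
      then have "ln ?P \<le> ln (exp 1 * laplace (exp L))"
        using P laplace_pos[of "exp L"] by (simp add: zero_less_measure_iff)
      then have "ln ?P \<le> 1 - neg_ln_laplace L"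
        using laplace_pos[of "exp L"] by (simp add: ln_mult neg_ln_laplace_def)
      moreover have "g L * L\<^sup>2 = L\<^sup>2 / ln 2 + b * L + (D - 1)" using L by (simp add: g_def)
      ultimately show ?thesis using bD[of L] L(1) False by (simp add: neg_ln_def)
    qed (simp add: neg_ln_def)
    then have "ereal (g L) * ereal (L\<^sup>2) \<le> neg_ln ?P" by simp
    then show ?case using L unfolding L_def[symmetric] L(2)
      by (subst ereal_le_divide_pos) (auto simp: mult.commute)
  qed
  with lim show ?thesis by blast
qed

text \<open>Taking \<open>l = exp (5/4 * L)\<close> with \<open>L = - ln x\<close> makes
  \<open>l * x = exp (L / 4)\<close>, which outgrows every quadratic in \<open>L\<close>. The
  limiting constant stays strictly below the target, so the bound holds eventually without an error
  term.\<close>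

lemma eventually_neg_ln_le:
  "\<forall>\<^sub>F x in at_right 0. neg_ln (prob {\<omega> \<in> space M. T \<omega> \<le> x}) / ereal ((ln x)\<^sup>2) \<le> ereal (2 / ln 2)"
proof -
  obtain b D where bD: "\<And>L. 0 \<le> L \<Longrightarrow> neg_ln_laplace L \<le> L\<^sup>2 / (2 * ln (4/3)) + b * L + D"
    using neg_ln_laplace_le by blast
  define A where "A L = (5/4 * L)\<^sup>2 / (2 * ln (4/3)) + b * (5/4 * L) + D" for L :: real
  define c :: real where "c = 1 / ln (4/3)"
  have const: "25 / 32 * c < 2 / ln 2"
  proof -
    \<comment> \<open>Cleared of denominators, the claim is
      \<open>25 * ln 2 < 64 * ln (4/3)\<close>, an inequality between rational powers.\<close>
    have "ln ((2::real) ^ 25) < ln ((4/3) ^ 64)" by (subst ln_less_cancel_iff) (auto simp: power_divide)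
    then have "25 * ln 2 < 64 * ln (4/3 :: real)" using ln_realpow[of 2 25] ln_realpow[of "4/3" 64] by simp
    then show ?thesis by (simp add: c_def field_simps)
  qed
  have A: "A L = 25 / 32 * c * L\<^sup>2 + 5/4 * b * L + D" for L
    by (simp add: A_def c_def power2_eq_square)
  have "((\<lambda>L. (25 / 32 * c * L\<^sup>2 + 5/4 * b * L + D + ln 2) / L\<^sup>2) \<longlongrightarrow> 25 / 32 * c) at_top"
    by real_asymp
  then have ev1: "\<forall>\<^sub>F L in at_top. (A L + ln 2) / L\<^sup>2 < 2 / ln 2"
    unfolding A using const by (rule order_tendstoD)
  have "((\<lambda>L. (25 / 32 * c * L\<^sup>2 + 5/4 * b * L + D + ln 2) / exp (1/4 * L)) \<longlongrightarrow> 0) at_top"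
    by real_asymp
  then have ev2: "\<forall>\<^sub>F L in at_top. (A L + ln 2) / exp (1/4 * L) < 1"
    unfolding A by (rule order_tendstoD) simp
  have "filterlim (\<lambda>x::real. - ln x) at_top (at_right 0)" by real_asymp
  with eventually_conj[OF ev1 ev2]
  have "\<forall>\<^sub>F x in at_right 0. (A (- ln x) + ln 2) / (- ln x)\<^sup>2 < 2 / ln 2 \<and> (A (- ln x) + ln 2) / exp (1/4 * (- ln x)) < 1"
    by (rule eventually_compose_filterlim)
  moreover have "\<forall>\<^sub>F x in at_right 0. x < (1::real)" "\<forall>\<^sub>F x in at_right 0. 0 < (x::real)"
    by (auto intro: order_tendstoD eventually_at_right_less)
  ultimately show ?thesis
  proof eventually_elim
    case (elim x)
    define L where "L = - ln x"
    let ?P = "prob {\<omega> \<in> space M. T \<omega> \<le> x}"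
    have L: "0 < L" "(ln x)\<^sup>2 = L\<^sup>2" "x = exp (- L)" using elim by (auto simp: L_def)
    have AL: "A L + ln 2 < exp (1/4 * L)" "(A L + ln 2) / L\<^sup>2 < 2 / ln 2"
      using elim unfolding L_def[symmetric] by simp_all
    have "- ln (laplace (exp (5/4 * L))) \<le> A L"
      using bD[of "5/4 * L"] L(1) by (simp add: A_def neg_ln_laplace_def)
    then have "- A L \<le> ln (laplace (exp (5/4 * L)))" by simp
    then have "exp (- A L) \<le> laplace (exp (5/4 * L))"
      using laplace_pos by (subst (asm) ln_ge_iff) auto
    also have "\<dots> \<le> ?P + exp (- exp (5/4 * L) * x)" by (intro laplace_le_prob) simp
    also have "exp (5/4 * L) * x = exp (1/4 * L)" by (simp add: L(3) exp_add[symmetric])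
    then have "exp (- exp (5/4 * L) * x) = exp (- exp (1/4 * L))" by simp
    \<comment> \<open>The tail error is at most half of \<open>exp (- A L)\<close>, so the other
      half bounds the probability from below.\<close>
    also have "\<dots> \<le> exp (- (A L + ln 2))" using AL by simp
    also have "\<dots> = exp (- A L) / 2" by (simp add: exp_diff)
    finally have P: "exp (- A L) / 2 \<le> ?P" by simp
    \<comment> \<open>Positivity excludes the infinite value of \<open>neg_ln\<close>.\<close>
    then have P0: "0 < ?P" by (rule less_le_trans[rotated]) simp
    have "ln (exp (- A L) / 2) \<le> ln ?P" using P P0 by simp
    then have "- ln ?P \<le> A L + ln 2" by (simp add: ln_div)
    then have "- ln ?P / L\<^sup>2 \<le> (A L + ln 2) / L\<^sup>2" by (intro divide_right_mono) auto
    with AL have "- ln ?P / L\<^sup>2 \<le> 2 / ln 2" by linarith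
    then show ?case using P0 L by (simp add: neg_ln_def)
  qed
qed

end

theorem proposition9:
  fixes M :: "'a measure" and T :: "'a \<Rightarrow> real"
  assumes "is_T_infinity M T"
  shows "ereal (1 / ln 2) \<le>
           Liminf (at_right 0) (\<lambda>x::real. neg_ln (measure M {\<omega> \<in> space M. T \<omega> \<le> x}) / ereal ((ln x)\<^sup>2))
       \<and> Liminf (at_right 0) (\<lambda>x::real. neg_ln (measure M {\<omega> \<in> space M. T \<omega> \<le> x}) / ereal ((ln x)\<^sup>2))
           \<le> Limsup (at_right 0) (\<lambda>x::real. neg_ln (measure M {\<omega> \<in> space M. T \<omega> \<le> x}) / ereal ((ln x)\<^sup>2))
       \<and> Limsup (at_right 0) (\<lambda>x::real. neg_ln (measure M {\<omega> \<in> space M. T \<omega> \<le> x}) / ereal ((ln x)\<^sup>2))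
           \<le> ereal (2 / ln 2)"
proof (intro conjI)
  interpret T_infinity M T by (rule T_infinity.intro[OF assms])
  let ?F = "\<lambda>x::real. neg_ln (measure M {\<omega> \<in> space M. T \<omega> \<le> x}) / ereal ((ln x)\<^sup>2)"
  obtain f where f: "(f \<longlongrightarrow> 1 / ln 2) (at_right 0)" "\<forall>\<^sub>F x in at_right 0. ereal (f x) \<le> ?F x"
    using eventually_neg_ln_ge by blast
  have "ereal (1 / ln 2) = Liminf (at_right 0) (\<lambda>x. ereal (f x))"
    using f(1) by (intro lim_imp_Liminf[symmetric] tendsto_ereal) auto
  also have "\<dots> \<le> Liminf (at_right 0) ?F" by (rule Liminf_mono[OF f(2)])
  finally show "ereal (1 / ln 2) \<le> Liminf (at_right 0) ?F" .
  show "Liminf (at_right 0) ?F \<le> Limsup (at_right 0) ?F" by (rule Liminf_le_Limsup) simp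
  show "Limsup (at_right 0) ?F \<le> ereal (2 / ln 2)" by (rule Limsup_bounded[OF eventually_neg_ln_le])
qed

end
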